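(* Let $n \geq 2$ and let $P \subseteq \mathbb{R}^n$ be a full-dimensional convex set. Then the depth of the integer hull of $P$ is less than $\sqrt{\frac{n+1}{2}}$, i.e. \[ \operatorname{depth}_P(\operatorname{conv}(P \cap \mathbb{Z}^n)) < \sqrt{\tfrac{n+1}{2}}. \]
   Context: $\|\cdot\|$ is the Euclidean norm on $\mathbb{R}^n$, and $B(x,r) := \{y \in \mathbb{R}^n : \|y-x\| \le r\}$ for $r \in \mathbb{R}_+$. For $P \subseteq \mathbb{R}^n$ and $x \in P$, $\operatorname{depth}_P(x) := \sup\{ r \in \mathbb{R}_+ : B(x,r) \cap \operatorname{aff}(P) \subseteq P\}$, where $\operatorname{aff}(P)$ is the affine hull of $P$. For $S \subseteq P$, $\operatorname{depth}_P(S) := \sup\{\operatorname{depth}_P(x) : x \in P \setminus S\}$. Suprema are taken in $[0,+\infty]$, so the supremum of the empty set is $0$. The integer hull of $P$ is $\operatorname{conv}(P \cap \mathbb{Z}^n)$. *)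

theory Defs
  imports "HOL-Analysis.Analysis"
begin

(* Depths are elements of [0, \<infinity>], i.e. of ennreal, so that a supremum always exists and the
   supremum of the empty set is 0. *)

definition point_depth :: "'a::euclidean_space set \<Rightarrow> 'a \<Rightarrow> ennreal" where
  "point_depth P x = Sup (ennreal ` {r. 0 \<le> r \<and> cball x r \<inter> affine hull P \<subseteq> P})"

definition set_depth :: "'a::euclidean_space set \<Rightarrow> 'a set \<Rightarrow> ennreal" where
  "set_depth P S = (SUP x\<in>P - S. point_depth P x)"

definition integer_lattice :: "(real ^ 'n) set" where
  "integer_lattice = {z. \<forall>i. z $ i \<in> \<int>}"

definition integer_hull :: "(real ^ 'n) set \<Rightarrow> (real ^ 'n) set" where
  "integer_hull P = convex hull (P \<inter> integer_lattice)"

end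

theory Submission
  imports Defs
begin

text \<open>
  Every point \<open>x\<close> lies in the convex hull of the integer points at distance at most
  \<open>sqrt ((n + 3) / 4)\<close> from it, and \<open>(n + 3) / 4 < (n + 1) / 2\<close> as soon as \<open>n \<ge> 2\<close>.
  As only finitely many integer points are involved, it suffices to find, for every direction \<open>c\<close>,
  an integer point \<open>z\<close> that close to \<open>x\<close> with \<open>c \<bullet> (z - x) \<ge> 0\<close>. For \<open>z\<close> a vertex of the unit cell
  of \<open>x\<close>, the squared distance is an affine function of \<open>z\<close>, whose extension to the cell has value
  \<open>\<Sum> f (1 - f) \<le> n / 4\<close> at \<open>x\<close> itself (\<open>f\<close> the fractional parts). Moving \<open>x\<close> along lines inside the
  cell on which neither \<open>c\<close> decreases nor the affine function increases makes all coordinates but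
  one integral; rounding the last one in the direction favoured by \<open>c\<close> gives \<open>z\<close>, and together with
  its own term \<open>f (1 - f)\<close> this coordinate costs at most 1.
\<close>

section \<open>Moving points inside the unit cube\<close>

lemma exit_time_unit_interval:
  fixes y u :: real
  assumes "0 \<le> y" "y \<le> 1" "u \<noteq> 0"
  shows "\<exists>t\<ge>0. y + t * u \<in> {0, 1} \<and> (\<forall>s. 0 \<le> s \<and> s \<le> t \<longrightarrow> 0 \<le> y + s * u \<and> y + s * u \<le> 1)"
proof (cases "u > 0")
  case True
  show ?thesis
  proof (intro exI[of _ "(1 - y) / u"] conjI allI impI)
    fix s assume s: "0 \<le> s \<and> s \<le> (1 - y) / u"
    show "0 \<le> y + s * u" using assms True s by simp
    show "y + s * u \<le> 1" using True s by (simp add: pos_le_divide_eq)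
  qed (use assms True in auto)
next
  case False
  then have u: "u < 0" using assms by simp
  show ?thesis
  proof (intro exI[of _ "y / (- u)"] conjI allI impI)
    fix s assume s: "0 \<le> s \<and> s \<le> y / (- u)"
    then have "s * (- u) \<le> y" using u by (subst (asm) pos_le_divide_eq) auto
    then show "0 \<le> y + s * u" by simp
    show "y + s * u \<le> 1" using assms u s mult_nonneg_nonpos[of s u] by simp
  qed (use assms u in \<open>auto simp: divide_simps\<close>)
qed

text \<open>The smaller of the two coordinatewise exit times works: until then both coordinates stay
  in [0, 1]. A coordinate of velocity 0 never leaves and imposes no bound.\<close>

lemma exit_unit_square:
  fixes p q u v :: real
  assumes "0 \<le> p" "p \<le> 1" "0 \<le> q" "q \<le> 1" "u \<noteq> 0 \<or> v \<noteq> 0"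
  shows "\<exists>t\<ge>0. 0 \<le> p + t * u \<and> p + t * u \<le> 1 \<and> 0 \<le> q + t * v \<and> q + t * v \<le> 1 \<and>
    (p + t * u \<in> {0, 1} \<or> q + t * v \<in> {0, 1})"
proof -
  consider "u = 0" "v \<noteq> 0" | "u \<noteq> 0" "v = 0" | "u \<noteq> 0" "v \<noteq> 0" using assms by blast
  then show ?thesis
  proof cases
    case 1
    then show ?thesis using exit_time_unit_interval[of q v] assms by fastforce
  next
    case 2
    then show ?thesis using exit_time_unit_interval[of p u] assms by fastforce
  next
    case 3
    obtain t where t: "t \<ge> 0" "p + t * u \<in> {0, 1}"
      "\<And>s. 0 \<le> s \<Longrightarrow> s \<le> t \<Longrightarrow> 0 \<le> p + s * u \<and> p + s * u \<le> 1"
      using exit_time_unit_interval[of p u] assms 3 by blast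
    obtain t' where t': "t' \<ge> 0" "q + t' * v \<in> {0, 1}"
      "\<And>s. 0 \<le> s \<Longrightarrow> s \<le> t' \<Longrightarrow> 0 \<le> q + s * v \<and> q + s * v \<le> 1"
      using exit_time_unit_interval[of q v] assms 3 by blast
    show ?thesis
    proof (cases "t \<le> t'")
      case True
      then show ?thesis using t t' by blast
    next
      case False
      then have "t' \<le> t" by simp
      then show ?thesis using t t' by blast
    qed
  qed
qed

text \<open>In two dimensions some line keeps the \<open>c\<close>, \<open>d\<close> functional
  constant. Follow it in the sense that does not increase the \<open>a\<close>, \<open>b\<close>
  functional, until the boundary of the square is hit.\<close>

lemma round_one_of_two:
  fixes p q a b c d :: real
  assumes "0 \<le> p" "p \<le> 1" "0 \<le> q" "q \<le> 1"
  obtains p' q' where "0 \<le> p'" "p' \<le> 1" "0 \<le> q'" "q' \<le> 1" "p' \<in> {0, 1} \<or> q' \<in> {0, 1}"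
    "c * p' + d * q' \<ge> c * p + d * q" "a * p' + b * q' \<le> a * p + b * q"
proof -
  obtain u v :: real where uv: "u \<noteq> 0 \<or> v \<noteq> 0" "c * u + d * v = 0"
  proof (cases "c = 0 \<and> d = 0")
    case True
    then show ?thesis using that[of 1 0] by simp
  next
    case False
    then show ?thesis using that[of d "- c"] by auto
  qed
  \<comment> \<open>\<open>\<sigma>\<close> is a sign orienting the line so that the second
    functional does not increase.\<close>
  obtain \<sigma> :: real where \<sigma>: "\<sigma> \<noteq> 0" "\<sigma> * (a * u + b * v) \<le> 0"
    by (cases "a * u + b * v \<le> 0") (auto intro: that[of 1] that[of "-1"])
  obtain t where t: "t \<ge> 0" "0 \<le> p + t * (\<sigma> * u)" "p + t * (\<sigma> * u) \<le> 1"
      "0 \<le> q + t * (\<sigma> * v)" "q + t * (\<sigma> * v) \<le> 1"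
      "p + t * (\<sigma> * u) \<in> {0, 1} \<or> q + t * (\<sigma> * v) \<in> {0, 1}"
    using exit_unit_square[of p q "\<sigma> * u" "\<sigma> * v"] assms uv \<sigma> by auto
  show ?thesis
  proof (rule that[OF t(2-6)])
    have "c * (p + t * (\<sigma> * u)) + d * (q + t * (\<sigma> * v)) = c * p + d * q + t * \<sigma> * (c * u + d * v)"
      by (simp add: algebra_simps)
    then show "c * (p + t * (\<sigma> * u)) + d * (q + t * (\<sigma> * v)) \<ge> c * p + d * q"
      using uv by simp
    have "a * (p + t * (\<sigma> * u)) + b * (q + t * (\<sigma> * v)) = a * p + b * q + t * (\<sigma> * (a * u + b * v))"
      by (simp add: algebra_simps)
    then show "a * (p + t * (\<sigma> * u)) + b * (q + t * (\<sigma> * v)) \<le> a * p + b * q"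
      using \<sigma> t(1) mult_nonneg_nonpos[of t] by simp
  qed
qed

text \<open>Induction on the index set: the new coordinate \<open>k\<close> is paired with the
  exceptional coordinate \<open>j\<close> of the smaller set. Making one of the two integral leaves
  the other as the only exception.\<close>

lemma round_all_but_one:
  fixes a c y :: "'i \<Rightarrow> real"
  assumes "finite I" "I \<noteq> {}" "\<And>i. i \<in> I \<Longrightarrow> 0 \<le> y i \<and> y i \<le> 1"
  shows "\<exists>w. \<exists>j\<in>I. 0 \<le> w j \<and> w j \<le> 1 \<and> (\<forall>i\<in>I - {j}. w i \<in> {0, 1}) \<and>
    (\<Sum>i\<in>I. c i * w i) \<ge> (\<Sum>i\<in>I. c i * y i) \<and> (\<Sum>i\<in>I. a i * w i) \<le> (\<Sum>i\<in>I. a i * y i)"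
  using assms
proof (induction I rule: finite_ne_induct)
  case (singleton x)
  then show ?case by (intro exI[of _ y]) auto
next
  case (insert k F)
  obtain w j where w: "j \<in> F" "0 \<le> w j" "w j \<le> 1" "\<And>i. i \<in> F - {j} \<Longrightarrow> w i \<in> {0, 1}"
      "(\<Sum>i\<in>F. c i * w i) \<ge> (\<Sum>i\<in>F. c i * y i)" "(\<Sum>i\<in>F. a i * w i) \<le> (\<Sum>i\<in>F. a i * y i)"
    using insert.IH insert.prems by blast
  have yk: "0 \<le> y k" "y k \<le> 1" using insert.prems by auto
  obtain p q where pq: "0 \<le> p" "p \<le> 1" "0 \<le> q" "q \<le> 1" "p \<in> {0, 1} \<or> q \<in> {0, 1}"
      "c k * p + c j * q \<ge> c k * y k + c j * w j" "a k * p + a j * q \<le> a k * y k + a j * w j"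
    using round_one_of_two[OF yk w(2,3), of "c k" "c j" "a k" "a j"] by metis
  define w' where "w' = w(k := p, j := q)"
  have kj: "k \<noteq> j" using w(1) insert.hyps by auto
  have split: "(\<Sum>i\<in>insert k F. g i * h i) = g k * h k + g j * h j + (\<Sum>i\<in>F - {j}. g i * h i)"
    for g h :: "'i \<Rightarrow> real"
    using w(1) insert.hyps by (simp add: sum.remove[of F j])
  have split': "(\<Sum>i\<in>F. g i * h i) = g j * h j + (\<Sum>i\<in>F - {j}. g i * h i)"
    for g h :: "'i \<Rightarrow> real"
    using w(1) insert.hyps by (simp add: sum.remove[of F j])
  have same: "(\<Sum>i\<in>F - {j}. g i * w' i) = (\<Sum>i\<in>F - {j}. g i * w i)" for g :: "'i \<Rightarrow> real"
    using insert.hyps by (intro sum.cong) (auto simp: w'_def)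
  have w'k: "w' k = p" "w' j = q" using kj by (auto simp: w'_def)
  have C: "(\<Sum>i\<in>insert k F. c i * w' i) \<ge> (\<Sum>i\<in>insert k F. c i * y i)"
    using pq(6) w(5) unfolding split split' same w'k by linarith
  have A: "(\<Sum>i\<in>insert k F. a i * w' i) \<le> (\<Sum>i\<in>insert k F. a i * y i)"
    using pq(7) w(6) unfolding split split' same w'k by linarith
  have rest: "w' i \<in> {0, 1}" if "i \<in> F - {j}" for i
    using w(4)[OF that] that insert.hyps by (auto simp: w'_def)
  show ?case
  proof (cases "p \<in> {0, 1}")
    case True
    then have "\<forall>i\<in>insert k F - {j}. w' i \<in> {0, 1}" using rest w'k by blast
    then show ?thesis using C A w'k pq w(1) by (intro exI[of _ w'] bexI[of _ j]) auto
  next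
    case False
    then have "\<forall>i\<in>insert k F - {k}. w' i \<in> {0, 1}" using rest w'k pq(5) by blast
    then show ?thesis using C A w'k pq by (intro exI[of _ w'] bexI[of _ k]) auto
  qed
qed

section \<open>Rounding to a close lattice point\<close>

lemma integer_rounding_in_direction:
  fixes c x :: "'i \<Rightarrow> real"
  assumes "finite I" "I \<noteq> {}"
  obtains z where "\<And>i. i \<in> I \<Longrightarrow> z i \<in> \<int>" "(\<Sum>i\<in>I. c i * (z i - x i)) \<ge> 0"
    "(\<Sum>i\<in>I. (z i - x i)\<^sup>2) \<le> (real (card I) + 3) / 4"
proof -
  define f where "f i = frac (x i)" for i
  have f: "0 \<le> f i" "f i \<le> 1" for i using frac_lt_1[of "x i"] by (auto simp: f_def)
  \<comment> \<open>The weights \<open>1 - 2 * f i\<close> come from (v - f)^2 = f^2 + (1 - 2 f) v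
    for v in {0, 1}: they make the squared distance affine on cube vertices.\<close>
  obtain w j where w: "j \<in> I" "0 \<le> w j" "w j \<le> 1" "\<And>i. i \<in> I - {j} \<Longrightarrow> w i \<in> {0, 1}"
      "(\<Sum>i\<in>I. c i * w i) \<ge> (\<Sum>i\<in>I. c i * f i)"
      "(\<Sum>i\<in>I. (1 - 2 * f i) * w i) \<le> (\<Sum>i\<in>I. (1 - 2 * f i) * f i)"
    using round_all_but_one[OF assms, of f c "\<lambda>i. 1 - 2 * f i"] f by blast
  \<comment> \<open>Rounding the last coordinate by the sign of \<open>c j\<close> cannot decrease
    the \<open>c\<close> functional; it may increase the distance.\<close>
  define b :: real where "b = (if c j \<ge> 0 then 1 else 0)"
  define v where "v = w(j := b)"
  define z where "z i = of_int \<lfloor>x i\<rfloor> + v i" for i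
  have v01: "v i \<in> {0, 1}" if "i \<in> I" for i using that w(4) by (auto simp: v_def b_def)
  have zx: "z i - x i = v i - f i" for i by (simp add: z_def f_def frac_def)
  have split: "(\<Sum>i\<in>I. g i) = g j + (\<Sum>i\<in>I - {j}. g i)" for g :: "'i \<Rightarrow> real"
    using w(1) assms by (simp add: sum.remove)
  have same: "(\<Sum>i\<in>I - {j}. g i * v i) = (\<Sum>i\<in>I - {j}. g i * w i)" for g :: "'i \<Rightarrow> real"
    by (intro sum.cong) (auto simp: v_def)
  have vj: "v j = b" by (simp add: v_def)
  show ?thesis
  proof (rule that[of z])
    show "z i \<in> \<int>" if "i \<in> I" for i using v01[OF that] by (auto simp: z_def)
    have "c j * b \<ge> c j * w j"
      using w(2,3) by (auto simp: b_def mult_left_le mult_nonpos_nonneg)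
    then have "(\<Sum>i\<in>I. c i * v i) \<ge> (\<Sum>i\<in>I. c i * w i)"
      by (subst (1 2) split) (simp add: same vj)
    then show "(\<Sum>i\<in>I. c i * (z i - x i)) \<ge> 0"
      using w(5) by (simp add: zx right_diff_distrib sum_subtractf)
    have "(z i - x i)\<^sup>2 = (f i)\<^sup>2 + (1 - 2 * f i) * v i" if "i \<in> I" for i
      using v01[OF that] by (auto simp: zx power2_eq_square algebra_simps)
    then have "(\<Sum>i\<in>I. (z i - x i)\<^sup>2) = (\<Sum>i\<in>I. (f i)\<^sup>2) + (\<Sum>i\<in>I. (1 - 2 * f i) * v i)"
      by (simp add: sum.distrib)
    also have "(\<Sum>i\<in>I. (1 - 2 * f i) * v i) = (\<Sum>i\<in>I. (1 - 2 * f i) * w i) + (1 - 2 * f j) * (b - w j)"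
      unfolding split[of "\<lambda>i. (1 - 2 * f i) * v i"] split[of "\<lambda>i. (1 - 2 * f i) * w i"] same vj
      by (simp add: algebra_simps)
    also have "(1 - 2 * f j) * (b - w j) \<le> \<bar>1 - 2 * f j\<bar>"
    proof -
      have "\<bar>b - w j\<bar> \<le> 1" using w(2,3) by (auto simp: b_def)
      then have "\<bar>1 - 2 * f j\<bar> * \<bar>b - w j\<bar> \<le> \<bar>1 - 2 * f j\<bar>" by (simp add: mult_left_le)
      then show ?thesis by (metis abs_ge_self abs_mult order_trans)
    qed
    also have "(\<Sum>i\<in>I. (1 - 2 * f i) * w i) \<le> (\<Sum>i\<in>I. (1 - 2 * f i) * f i)" by (rule w(6))
    finally have "(\<Sum>i\<in>I. (z i - x i)\<^sup>2)
        \<le> (\<Sum>i\<in>I. (f i)\<^sup>2 + (1 - 2 * f i) * f i) + \<bar>1 - 2 * f j\<bar>"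
      by (simp add: sum.distrib)
    also have "(\<Sum>i\<in>I. (f i)\<^sup>2 + (1 - 2 * f i) * f i) = (\<Sum>i\<in>I. f i * (1 - f i))"
      by (intro sum.cong) (auto simp: power2_eq_square algebra_simps)
    \<comment> \<open>The term of \<open>j\<close> is kept apart to be bounded jointly with the
      rounding cost. Separate bounds 1/4 and 1 would total (n + 4) / 4, which equals (n + 1) / 2 for
      n = 2.\<close>
    also have "\<dots> = f j * (1 - f j) + (\<Sum>i\<in>I - {j}. f i * (1 - f i))" by (rule split)
    also have "(\<Sum>i\<in>I - {j}. f i * (1 - f i)) \<le> (\<Sum>i\<in>I - {j}. 1 / 4)"
    proof (rule sum_mono)
      fix i
      have "0 \<le> (f i - 1 / 2)\<^sup>2" by simp
      then show "f i * (1 - f i) \<le> 1 / 4" by (simp add: power2_eq_square algebra_simps)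
    qed
    also have "\<dots> = (real (card I) - 1) / 4"
    proof -
      have "card I \<ge> 1" using w(1) assms by (simp add: Suc_leI card_gt_0_iff)
      then show ?thesis using w(1) by (simp add: of_nat_diff)
    qed
    finally have le: "(\<Sum>i\<in>I. (z i - x i)\<^sup>2)
      \<le> f j * (1 - f j) + \<bar>1 - 2 * f j\<bar> + (real (card I) - 1) / 4" by linarith
    have "f j * (1 - f j) + \<bar>1 - 2 * f j\<bar> \<le> 1"
    proof (cases "f j \<le> 1 / 2")
      case True
      then show ?thesis using f[of j] by (simp add: algebra_simps)
    next
      case False
      \<comment> \<open>This product is exactly 1 minus the left-hand side when f > 1/2.\<close>
      moreover have "0 \<le> (1 - f j) * (2 - f j)" using f[of j] by simp
      ultimately show ?thesis by (simp add: algebra_simps)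
    qed
    with le show "(\<Sum>i\<in>I. (z i - x i)\<^sup>2) \<le> (real (card I) + 3) / 4" by (simp add: field_simps)
  qed
qed

section \<open>Separation from the nearby lattice points\<close>

lemma finite_integer_lattice_Int_cball:
  "finite (integer_lattice \<inter> cball x r :: (real ^ 'n) set)"
proof -
  have sub: "(integer_lattice \<inter> cball x r :: (real ^ 'n) set)
    \<subseteq> vec_lambda ` (UNIV \<rightarrow>\<^sub>E (\<Union>i. {k \<in> \<int>. x $ i - r \<le> k \<and> k \<le> x $ i + r}))"
  proof
    fix z :: "real ^ 'n" assume z: "z \<in> integer_lattice \<inter> cball x r"
    have "\<bar>x $ i - z $ i\<bar> \<le> r" for i
      using component_le_norm_cart[of "x - z" i] z by (simp add: dist_norm)
    then have "x $ i - r \<le> z $ i \<and> z $ i \<le> x $ i + r" for i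
      by (simp add: abs_le_iff) (metis add.commute diff_le_eq minus_diff_eq)
    then have "vec_nth z \<in> UNIV \<rightarrow>\<^sub>E (\<Union>i. {k \<in> \<int>. x $ i - r \<le> k \<and> k \<le> x $ i + r})"
      using z by (auto simp: integer_lattice_def)
    then show "z \<in> vec_lambda ` (UNIV \<rightarrow>\<^sub>E (\<Union>i. {k \<in> \<int>. x $ i - r \<le> k \<and> k \<le> x $ i + r}))"
      by (intro image_eqI[of _ _ "vec_nth z"]) (simp_all add: vec_nth_inverse)
  qed
  have "finite (\<Union>i. {k \<in> \<int>. x $ i - r \<le> k \<and> k \<le> x $ i + r})"
    by (intro finite_UN_I finite_int_segment) simp
  then show ?thesis
    by (intro finite_subset[OF sub] finite_imageI finite_PiE) auto
qed

lemma mem_convex_hull_near_integers: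
  fixes x :: "real ^ 'n"
  assumes "(real CARD('n) + 3) / 4 \<le> r\<^sup>2" "0 \<le> r"
  shows "x \<in> convex hull (integer_lattice \<inter> cball x r)"
proof (rule ccontr)
  let ?S = "integer_lattice \<inter> cball x r"
  assume "x \<notin> convex hull ?S"
  \<comment> \<open>Finiteness of the lattice points in the ball makes their hull compact, hence
    closed, as strict separation requires.\<close>
  moreover have "closed (convex hull ?S)"
    by (simp add: finite_integer_lattice_Int_cball finite_imp_compact_convex_hull compact_imp_closed)
  ultimately obtain c b where c: "c \<bullet> x < b" "\<And>z. z \<in> convex hull ?S \<Longrightarrow> b < c \<bullet> z"
    using separating_hyperplane_closed_point[of "convex hull ?S" x] by auto
  \<comment> \<open>Rounding in direction \<open>- c\<close> gives a lattice point of the ball on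
    the same side of the hyperplane as \<open>x\<close>, a contradiction.\<close>
  obtain z where z: "\<And>i. z i \<in> \<int>" "(\<Sum>i\<in>UNIV. (- c $ i) * (z i - x $ i)) \<ge> 0"
      "(\<Sum>i\<in>UNIV. (z i - x $ i)\<^sup>2) \<le> (real CARD('n) + 3) / 4"
    using integer_rounding_in_direction[of "UNIV :: 'n set" "\<lambda>i. - c $ i" "vec_nth x"] by auto
  define y :: "real ^ 'n" where "y = vec_lambda z"
  have "(norm (y - x))\<^sup>2 \<le> r\<^sup>2"
    using z(3) assms(1)
    by (simp add: y_def norm_vec_def L2_set_def sum_nonneg)
  then have "norm (y - x) \<le> r" using assms(2) by (rule power2_le_imp_le)
  then have "y \<in> ?S"
    using z(1) by (simp add: integer_lattice_def y_def dist_norm norm_minus_commute)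
  then have "b < c \<bullet> y" by (intro c(2) hull_inc)
  moreover have "c \<bullet> y \<le> c \<bullet> x"
    using z(2) by (simp add: inner_vec_def y_def algebra_simps sum_subtractf sum_negf)
  ultimately show False using c(1) by simp
qed

theorem theorem1:
  fixes P :: "(real ^ 'n) set"
  assumes "CARD('n) \<ge> 2"
    and "convex P"
    and "aff_dim P = int CARD('n)"
  shows "set_depth P (integer_hull P) < ennreal (sqrt ((real CARD('n) + 1) / 2))"
proof -
  let ?R = "sqrt ((real CARD('n) + 3) / 4)"
  \<comment> \<open>Full dimension turns the depth condition into
    \<open>cball x r \<subseteq> P\<close>, so the lattice points near \<open>x\<close> lie in
    \<open>P\<close>.\<close>
  have aff: "affine hull P = UNIV"
    using assms(3) by (simp flip: aff_dim_eq_full)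
  have "point_depth P x \<le> ennreal ?R" if x: "x \<in> P - integer_hull P" for x
    unfolding point_depth_def
  proof (intro Sup_least, clarify)
    fix r :: real assume r: "0 \<le> r" "cball x r \<inter> affine hull P \<subseteq> P"
    have "r \<le> ?R"
    proof (rule ccontr)
      assume "\<not> r \<le> ?R"
      then have "(real CARD('n) + 3) / 4 \<le> r\<^sup>2"
        by (intro sqrt_le_D) simp
      then have "x \<in> convex hull (integer_lattice \<inter> cball x r)"
        using r(1) by (rule mem_convex_hull_near_integers)
      also have "\<dots> \<subseteq> integer_hull P"
        unfolding integer_hull_def using r(2) aff by (intro hull_mono) auto
      finally show False using x by simp
    qed
    then show "ennreal r \<le> ennreal ?R" by (rule ennreal_leI)
  qed
  then have "set_depth P (integer_hull P) \<le> ennreal ?R"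
    unfolding set_depth_def by (rule SUP_least)
  \<comment> \<open>The bound \<open>?R\<close> is uniform in \<open>x\<close>, so strictness
    survives the supremum; (n + 3) / 4 < (n + 1) / 2 amounts to n > 1.\<close>
  also have "\<dots> < ennreal (sqrt ((real CARD('n) + 1) / 2))"
    using assms(1) by (intro ennreal_lessI) auto
  finally show ?thesis .
qed

end
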